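(* Fix $d\in\mathbb{N}$ and positive shape parameters $\gamma_1,\dots,\gamma_d$. Let $H_d$ be the reproducing kernel Hilbert space of real functions on $\mathbb{R}^d$ with reproducing kernel $K_d(\mathbf{x},\mathbf{t})=\exp\!\big(-\sum_{\ell=1}^d\gamma_\ell^2(x_\ell-t_\ell)^2\big)$. Let $e^{\rm wor-all}(n,H_d)$ and $e^{\rm wor-std}(n,H_d)$ be the $n$th minimal worst case errors of approximating the embedding $I_d:H_d\to\mathcal{L}_2(\mathbb{R}^d,\rho_d)$ defined in the context. Then for every $p>0$ there is a constant $C_{d,p}$, which may depend on $d$ and $p$ but not on $n$, such that $$e^{\rm wor-all}(n,H_d)\le e^{\rm wor-std}(n,H_d)\le C_{d,p}\,n^{-p}\qquad\text{for all } n\in\mathbb{N}.$$ Equivalently, the rates of convergence of both sequences $\{e^{\rm wor-all}(n,H_d)\}_{n}$ and $\{e^{\rm wor-std}(n,H_d)\}_{n}$ are infinite.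
   Context: $\rho_d(\mathbf{t})=\pi^{-d/2}\exp(-\|\mathbf{t}\|^2)$ is the Gaussian density on $\mathbb{R}^d$ with mean zero and covariance $\tfrac12 I$, and $\mathcal{L}_2=\mathcal{L}_2(\mathbb{R}^d,\rho_d)$ has norm $\|f\|_{\mathcal{L}_2}^2=\int_{\mathbb{R}^d}f(\mathbf{t})^2\rho_d(\mathbf{t})\,d\mathbf{t}$. $I_d f=f$ is the embedding of $H_d$ into $\mathcal{L}_2$. A linear algorithm has the form $A_n(f)=\sum_{j=1}^n L_j(f)a_j$ with $a_j\in\mathcal{L}_2$ and continuous linear functionals $L_j$ on $H_d$. Its worst case error is $e^{\rm wor}(A_n)=\sup_{\|f\|_{H_d}\le1}\|f-A_n(f)\|_{\mathcal{L}_2}$. $\Lambda^{\rm all}$ is the class of all continuous linear functionals on $H_d$. $\Lambda^{\rm std}$ is the class of function evaluations $f\mapsto f(\mathbf{t})$, $\mathbf{t}\in\mathbb{R}^d$. $e^{\rm wor-\cdot}(n,H_d)=\inf e^{\rm wor}(A_n)$, where the infimum is over all such $A_n$ with every $L_j$ in $\Lambda^{\rm all}$, respectively in $\Lambda^{\rm std}$. The rate of convergence of a nonincreasing sequence $\{e_n\}$ is $\sup\{\beta\ge0:\lim_{n\to\infty}e_n n^\beta=0\}$. *)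

theory Defs
  imports "HOL-Analysis.Analysis"
begin

definition gauss_kernel :: "('d::finite \<Rightarrow> real) \<Rightarrow> real^'d \<Rightarrow> real^'d \<Rightarrow> real" where
  "gauss_kernel \<gamma> x t = exp (- (\<Sum>l\<in>UNIV. (\<gamma> l)\<^sup>2 * (x $ l - t $ l)\<^sup>2))"

definition rho :: "real^'d::finite \<Rightarrow> real" where
  "rho t = pi powr (- real CARD('d) / 2) * exp (- (norm t)\<^sup>2)"

text \<open>Reproducing kernel Hilbert space of a positive definite kernel K:
  f belongs to H(K) with norm^2 <= M iff for all finitely many points x_i and
  coefficients c_i, (sum c_i f(x_i))^2 <= M * sum_i sum_j c_i c_j K(x_i,x_j)
  (Aronszajn's characterization of the RKHS and its norm).\<close>
definition rkhs_bound :: "('a \<Rightarrow> 'a \<Rightarrow> real) \<Rightarrow> ('a \<Rightarrow> real) \<Rightarrow> real \<Rightarrow> bool" where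
  "rkhs_bound K f M \<longleftrightarrow> 0 \<le> M \<and> (\<forall>(m::nat) (x::nat \<Rightarrow> 'a) (c::nat \<Rightarrow> real).
      (\<Sum>i<m. c i * f (x i))\<^sup>2 \<le> M * (\<Sum>i<m. \<Sum>j<m. c i * c j * K (x i) (x j)))"

definition rkhs :: "('a \<Rightarrow> 'a \<Rightarrow> real) \<Rightarrow> ('a \<Rightarrow> real) set" where
  "rkhs K = {f. \<exists>M. rkhs_bound K f M}"

definition rkhs_norm :: "('a \<Rightarrow> 'a \<Rightarrow> real) \<Rightarrow> ('a \<Rightarrow> real) \<Rightarrow> real" where
  "rkhs_norm K f = sqrt (Inf {M. rkhs_bound K f M})"

definition Lambda_all :: "('a \<Rightarrow> 'a \<Rightarrow> real) \<Rightarrow> (('a \<Rightarrow> real) \<Rightarrow> real) set" where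
  "Lambda_all K = {L. (\<forall>f\<in>rkhs K. \<forall>g\<in>rkhs K. \<forall>a b. L (\<lambda>x. a * f x + b * g x) = a * L f + b * L g)
                    \<and> (\<exists>C. \<forall>f\<in>rkhs K. \<bar>L f\<bar> \<le> C * rkhs_norm K f)}"

definition Lambda_std :: "(('a \<Rightarrow> real) \<Rightarrow> real) set" where
  "Lambda_std = {L. \<exists>t. \<forall>f. L f = f t}"

definition L2_rho :: "(real^'d::finite \<Rightarrow> real) set" where
  "L2_rho = {g. g \<in> borel_measurable lborel \<and> (\<integral>\<^sup>+ t. ennreal ((g t)\<^sup>2 * rho t) \<partial>lborel) < \<infinity>}"

definition enn_sqrt :: "ennreal \<Rightarrow> ennreal" where
  "enn_sqrt x = (if x = \<infinity> then \<infinity> else ennreal (sqrt (enn2real x)))"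

definition L2_rho_norm :: "(real^'d::finite \<Rightarrow> real) \<Rightarrow> ennreal" where
  "L2_rho_norm g = enn_sqrt (\<integral>\<^sup>+ t. ennreal ((g t)\<^sup>2 * rho t) \<partial>lborel)"

definition wce :: "('d::finite \<Rightarrow> real) \<Rightarrow> nat \<Rightarrow> (nat \<Rightarrow> (real^'d \<Rightarrow> real) \<Rightarrow> real)
                    \<Rightarrow> (nat \<Rightarrow> real^'d \<Rightarrow> real) \<Rightarrow> ennreal" where
  "wce \<gamma> n L a = (SUP f \<in> {f \<in> rkhs (gauss_kernel \<gamma>). rkhs_norm (gauss_kernel \<gamma>) f \<le> 1}.
      L2_rho_norm (\<lambda>t. f t - (\<Sum>j<n. L j f * a j t)))"

definition min_wce :: "('d::finite \<Rightarrow> real) \<Rightarrow> ((real^'d \<Rightarrow> real) \<Rightarrow> real) set \<Rightarrow> nat \<Rightarrow> ennreal" where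
  "min_wce \<gamma> Lam n = (INF (L, a) \<in> {(L, a). (\<forall>j<n. L j \<in> Lam \<and> a j \<in> L2_rho)}. wce \<gamma> n L a)"

definition e_wor_all :: "('d::finite \<Rightarrow> real) \<Rightarrow> nat \<Rightarrow> ennreal" where
  "e_wor_all \<gamma> n = min_wce \<gamma> (Lambda_all (gauss_kernel \<gamma>)) n"

definition e_wor_std :: "('d::finite \<Rightarrow> real) \<Rightarrow> nat \<Rightarrow> ennreal" where
  "e_wor_std \<gamma> n = min_wce \<gamma> Lambda_std n"

end

theory Submission
  imports Defs "HOL-Probability.Distributions"
begin

text \<open>
  Split the box \<open>[-k, k)\<^sup>d\<close> into cubes of side \<open>1 / k\<close>, interpolate on each cube by tensor
  products of Lagrange polynomials on \<open>m\<close> equispaced nodes per coordinate, and approximate by \<open>0\<close>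
  outside the box. On a line parallel to an axis, the squared norm of the interpolation error
  functional is a quadratic form in the Gaussian kernel. As the functional annihilates
  polynomials of degree less than \<open>m\<close>, this form only sees the Taylor remainder of the exponential
  and is \<open>O(k powr (- 2 * m))\<close>. Replacing the coordinates one after the other gives the uniform
  error \<open>O(k powr (- m))\<close> on the box, while outside it \<open>\<bar>f\<bar> \<le> 1\<close> and the Gaussian mass is
  \<open>O(exp (- k\<^sup>2 / 2))\<close>. With \<open>n = (2 * m * k\<^sup>2) ^ d\<close> points the error is therefore
  \<open>O(n powr (- m / (2 * d)))\<close>, and \<open>m\<close> is arbitrary.
\<close>

subsection \<open>Functionals on the reproducing kernel Hilbert space\<close>

text \<open>Renumbering \<open>I\<close> by a bijection lets later functionals be indexed by node
  sets instead of initial segments of the naturals.\<close>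

lemma rkhs_bound_finite:
  assumes "rkhs_bound K f M" "finite I"
  shows "(\<Sum>i\<in>I. c i * f (x i))\<^sup>2 \<le> M * (\<Sum>i\<in>I. \<Sum>j\<in>I. c i * c j * K (x i) (x j))"
proof -
  obtain b where b: "bij_betw b {..<card I} I"
    using ex_bij_betw_nat_finite[OF assms(2)] atLeast0LessThan by metis
  have "(\<Sum>i<card I. c (b i) * f (x (b i)))\<^sup>2
      \<le> M * (\<Sum>i<card I. \<Sum>j<card I. c (b i) * c (b j) * K (x (b i)) (x (b j)))"
    using assms(1) unfolding rkhs_bound_def by (auto dest!: spec[of _ "card I"] spec[of _ "\<lambda>i. x (b i)"] spec[of _ "\<lambda>i. c (b i)"])
  moreover have "(\<Sum>i<card I. c (b i) * f (x (b i))) = (\<Sum>i\<in>I. c i * f (x i))"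
    by (rule sum.reindex_bij_betw[OF b])
  moreover have "(\<Sum>i<card I. \<Sum>j<card I. c (b i) * c (b j) * K (x (b i)) (x (b j)))
      = (\<Sum>i\<in>I. \<Sum>j\<in>I. c i * c j * K (x i) (x j))"
    using sum.reindex_bij_betw[OF b, of "\<lambda>i. \<Sum>j\<in>I. c i * c j * K (x i) (x j)"]
      sum.reindex_bij_betw[OF b, of "\<lambda>j. c i * c j * K (x i) (x j)" for i]
    by simp
  ultimately show ?thesis by simp
qed

text \<open>The absolute value on the right makes positive definiteness of the kernel unnecessary.\<close>
lemma rkhs_norm_bound_finite:
  assumes "f \<in> rkhs K" "finite I"
  shows "(\<Sum>i\<in>I. c i * f (x i))\<^sup>2
      \<le> (rkhs_norm K f)\<^sup>2 * \<bar>\<Sum>i\<in>I. \<Sum>j\<in>I. c i * c j * K (x i) (x j)\<bar>"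
proof -
  define S where "S = {M. rkhs_bound K f M}"
  define Q where "Q = \<bar>\<Sum>i\<in>I. \<Sum>j\<in>I. c i * c j * K (x i) (x j)\<bar>"
  have ne: "S \<noteq> {}" using assms(1) by (auto simp: S_def rkhs_def)
  have nonneg: "0 \<le> M" if "M \<in> S" for M using that by (auto simp: S_def rkhs_bound_def)
  have norm: "(rkhs_norm K f)\<^sup>2 = Inf S"
    using cInf_greatest[OF ne nonneg] by (simp add: rkhs_norm_def S_def)
  have le: "(\<Sum>i\<in>I. c i * f (x i))\<^sup>2 \<le> M * Q" if "M \<in> S" for M
  proof -
    have "(\<Sum>i\<in>I. c i * f (x i))\<^sup>2 \<le> M * (\<Sum>i\<in>I. \<Sum>j\<in>I. c i * c j * K (x i) (x j))"
      using that assms(2) by (intro rkhs_bound_finite) (auto simp: S_def)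
    also have "\<dots> \<le> M * Q"
      unfolding Q_def using nonneg[OF that] by (intro mult_left_mono) auto
    finally show ?thesis .
  qed
  \<comment> \<open>For \<open>Q > 0\<close> the bound passes to the infimum after division by
    \<open>Q\<close>; for \<open>Q = 0\<close> a single admissible \<open>M\<close> already forces
    the left side to vanish.\<close>
  show ?thesis
  proof (cases "Q = 0")
    case True
    then show ?thesis using le ne norm Q_def by fastforce
  next
    case False
    then have "Q > 0" by (simp add: Q_def)
    then have "(\<Sum>i\<in>I. c i * f (x i))\<^sup>2 / Q \<le> Inf S"
      using le by (intro cInf_greatest[OF ne]) (simp add: field_simps)
    then show ?thesis using \<open>Q > 0\<close> unfolding norm Q_def[symmetric] by (simp add: field_simps)
  qed
qed

lemma rkhs_norm_nonneg:
  assumes "f \<in> rkhs K"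
  shows "0 \<le> rkhs_norm K f"
proof -
  have "0 \<le> Inf {M. rkhs_bound K f M}"
    using assms by (intro cInf_greatest) (auto simp: rkhs_def rkhs_bound_def)
  then show ?thesis by (simp add: rkhs_norm_def)
qed

text \<open>One-point case of the previous bound: \<open>gauss_kernel \<gamma> t t = 1\<close>, so
  evaluations have norm at most 1. This gives their continuity and bounds \<open>f\<close> where it
  is approximated by 0.\<close>

lemma abs_eval_le_rkhs_norm:
  assumes "f \<in> rkhs (gauss_kernel \<gamma>)"
  shows "\<bar>f t\<bar> \<le> rkhs_norm (gauss_kernel \<gamma>) f"
proof -
  have "(f t)\<^sup>2 \<le> (rkhs_norm (gauss_kernel \<gamma>) f)\<^sup>2"
    using rkhs_norm_bound_finite[OF assms, of "{()}" "\<lambda>_. 1" "\<lambda>_. t"]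
    by (simp add: gauss_kernel_def)
  then show ?thesis using rkhs_norm_nonneg[OF assms] by (simp add: abs_le_square_iff[symmetric])
qed

lemma Lambda_std_subset_all: "Lambda_std \<subseteq> Lambda_all (gauss_kernel \<gamma>)"
  using abs_eval_le_rkhs_norm by (fastforce simp: Lambda_std_def Lambda_all_def intro!: exI[of _ 1])

subsection \<open>Lagrange interpolation of functions in the Gaussian space\<close>

definition lagrange_weight :: "real set \<Rightarrow> real \<Rightarrow> real \<Rightarrow> real" where
  "lagrange_weight X x t = (\<Prod>y\<in>X - {x}. (t - y) / (x - y))"

text \<open>The interpolant of \<open>z ^ j\<close> has degree below \<open>card X\<close> and
  agrees with \<open>z ^ j\<close> at all \<open>card X\<close> nodes, so the two polynomials
  coincide.\<close>

lemma lagrange_weight_exact: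
  assumes "finite X" "j < card X"
  shows "(\<Sum>x\<in>X. lagrange_weight X x t * x ^ j) = t ^ j"
proof -
  define B where "B x = (\<Prod>y\<in>X - {x}. [:- y / (x - y), 1 / (x - y):])" for x
  define P where "P = (\<Sum>x\<in>X. smult (x ^ j) (B x))"
  have poly_B: "poly (B x) z = lagrange_weight X x z" for x z
    by (simp add: B_def lagrange_weight_def poly_prod diff_divide_distrib)
  have degB: "degree (B x) \<le> card X - 1" if "x \<in> X" for x
  proof -
    have "degree (B x) \<le> (\<Sum>y\<in>X - {x}. degree [:- y / (x - y), 1 / (x - y):])"
      unfolding B_def using assms(1) by (intro degree_prod_sum_le[unfolded comp_def]) auto
    also have "\<dots> \<le> (\<Sum>y\<in>X - {x}. 1)" by (intro sum_mono) simp
    also have "\<dots> = card X - 1" using that by simp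
    finally show ?thesis .
  qed
  have "degree P \<le> card X - 1"
    unfolding P_def using degB by (intro degree_sum_le) (auto simp: assms intro: order_trans[OF degree_smult_le])
  then have degP: "degree P < card X" using assms(2) by simp
  have "P = monom 1 j"
  proof (rule poly_eqI_degree[where A = X])
    fix z assume z: "z \<in> X"
    have "lagrange_weight X x z = (if x = z then 1 else 0)" if "x \<in> X" for x
      using z assms(1) by (auto simp: lagrange_weight_def intro!: prod_zero prod.neutral)
    then have "poly P z = (\<Sum>x\<in>X. x ^ j * (if x = z then 1 else 0))"
      by (simp add: P_def poly_sum poly_B cong: sum.cong)
    also have "\<dots> = z ^ j" using z assms(1) by (simp add: if_distrib cong: if_cong)
    finally show "poly P z = poly (monom 1 j) z" by (simp add: poly_monom)
  qed (use degP assms(2) in \<open>simp_all add: degree_monom_eq\<close>)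
  then have "poly P t = t ^ j" by (simp add: poly_monom)
  then show ?thesis by (simp add: P_def poly_sum poly_B mult.commute)
qed

text \<open>In Lagrange's form of the remainder the intermediate point is negative, so its
  exponential is at most 1; the factor \<open>1 / fact m\<close> is given away.\<close>

lemma exp_neg_Taylor_remainder:
  fixes y :: real
  assumes "0 \<le> y" "0 < m"
  shows "\<bar>exp (- y) - (\<Sum>k<m. (- y) ^ k / fact k)\<bar> \<le> y ^ m"
proof (cases "y = 0")
  case True
  obtain m' where "m = Suc m'" using assms(2) gr0_conv_Suc by blast
  then show ?thesis using True by (simp add: sum.lessThan_Suc_shift del: sum.lessThan_Suc)
next
  case False
  then have "\<exists>t>-y. t < 0 \<and> exp (- y) = (\<Sum>k<m. exp 0 / fact k * (- y) ^ k) + exp t / fact m * (- y) ^ m"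
    using assms by (intro Maclaurin_minus[where diff = "\<lambda>_. exp"]) (auto intro!: derivative_eq_intros)
  then obtain t where t: "t < 0" "exp (- y) = (\<Sum>k<m. (- y) ^ k / fact k) + exp t / fact m * (- y) ^ m"
    by auto
  have "exp t / fact m \<le> 1 / 1" using t(1) by (intro frac_le) auto
  then have "exp t / fact m * y ^ m \<le> 1 * y ^ m" using assms(1) by (intro mult_right_mono) auto
  then show ?thesis using t(2) assms(1) by (simp add: abs_mult power_abs)
qed

text \<open>Expanding \<open>(x i - x j) ^ (2 * k)\<close> with \<open>k < m\<close>, one of the two exponents of each monomial
  is below \<open>m\<close>, so the vanishing moments leave only the Taylor remainder of the exponential.\<close>
lemma gauss_form_vanishing_moments:
  fixes x c :: "'i \<Rightarrow> real"
  assumes I: "finite I" and "0 < m"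
    and mom: "\<And>j. j < m \<Longrightarrow> (\<Sum>i\<in>I. c i * x i ^ j) = 0"
    and dist: "\<And>i j. i \<in> I \<Longrightarrow> j \<in> I \<Longrightarrow> \<bar>x i - x j\<bar> \<le> h"
  shows "\<bar>\<Sum>i\<in>I. \<Sum>j\<in>I. c i * c j * exp (- (g\<^sup>2 * (x i - x j)\<^sup>2))\<bar>
      \<le> ((\<Sum>i\<in>I. \<bar>c i\<bar>) * (g * h) ^ m)\<^sup>2"
proof -
  \<comment> \<open>Taylor polynomial of the Gaussian: in \<open>u\<close> it contains only the
    powers \<open>u ^ (2 * k)\<close> with \<open>k < m\<close>, so its quadratic form vanishes term
    by term.\<close>
  define T where "T u = (\<Sum>k<m. (- (g\<^sup>2 * u\<^sup>2)) ^ k / fact k)" for u :: real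
  have pow: "(\<Sum>i\<in>I. \<Sum>j\<in>I. c i * c j * (x i - x j) ^ (2 * k)) = 0" if "k < m" for k
  proof -
    have "(\<Sum>i\<in>I. \<Sum>j\<in>I. c i * c j * (x i - x j) ^ (2 * k))
        = (\<Sum>i\<in>I. \<Sum>j\<in>I. \<Sum>b\<le>2 * k. of_nat (2 * k choose b) * (-1) ^ (2 * k - b) *
            ((c i * x i ^ b) * (c j * x j ^ (2 * k - b))))"
    proof (intro sum.cong refl)
      fix i j
      have "(x i - x j) ^ (2 * k) = (\<Sum>b\<le>2 * k. of_nat (2 * k choose b) * x i ^ b * (- x j) ^ (2 * k - b))"
        using binomial_ring[of "x i" "- x j" "2 * k"] by simp
      then show "c i * c j * (x i - x j) ^ (2 * k) = (\<Sum>b\<le>2 * k. of_nat (2 * k choose b) * (-1) ^ (2 * k - b) *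
            ((c i * x i ^ b) * (c j * x j ^ (2 * k - b))))"
        by (simp add: sum_distrib_left power_minus[of "x j"] mult_ac)
    qed
    also have "\<dots> = (\<Sum>i\<in>I. \<Sum>b\<le>2 * k. \<Sum>j\<in>I. of_nat (2 * k choose b) * (-1) ^ (2 * k - b) *
            ((c i * x i ^ b) * (c j * x j ^ (2 * k - b))))"
      by (intro sum.cong refl sum.swap)
    also have "\<dots> = (\<Sum>b\<le>2 * k. \<Sum>i\<in>I. \<Sum>j\<in>I. of_nat (2 * k choose b) * (-1) ^ (2 * k - b) *
            ((c i * x i ^ b) * (c j * x j ^ (2 * k - b))))"
      by (rule sum.swap)
    also have "\<dots> = (\<Sum>b\<le>2 * k. of_nat (2 * k choose b) * (-1) ^ (2 * k - b) *
            ((\<Sum>i\<in>I. c i * x i ^ b) * (\<Sum>j\<in>I. c j * x j ^ (2 * k - b))))"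
      unfolding sum_product by (simp only: sum_distrib_left)
    also have "\<dots> = 0"
    proof (intro sum.neutral ballI)
      fix b
      have "b < m \<or> 2 * k - b < m" using that by linarith
      then show "of_nat (2 * k choose b) * (-1) ^ (2 * k - b) *
            ((\<Sum>i\<in>I. c i * x i ^ b) * (\<Sum>j\<in>I. c j * x j ^ (2 * k - b))) = 0"
        using mom by auto
    qed
    finally show ?thesis .
  qed
  have T0: "(\<Sum>i\<in>I. \<Sum>j\<in>I. c i * c j * T (x i - x j)) = 0"
  proof -
    have "(\<Sum>i\<in>I. \<Sum>j\<in>I. c i * c j * T (x i - x j))
        = (\<Sum>i\<in>I. \<Sum>j\<in>I. \<Sum>k<m. (- (g\<^sup>2)) ^ k / fact k * (c i * c j * (x i - x j) ^ (2 * k)))"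
    proof (intro sum.cong refl)
      fix i j
      have "(- (g\<^sup>2 * (x i - x j)\<^sup>2)) ^ k = (- (g\<^sup>2)) ^ k * (x i - x j) ^ (2 * k)" for k
        by (simp only: power_mult power_mult_distrib[symmetric] mult_minus_left)
      then show "c i * c j * T (x i - x j)
          = (\<Sum>k<m. (- (g\<^sup>2)) ^ k / fact k * (c i * c j * (x i - x j) ^ (2 * k)))"
        by (simp add: T_def sum_distrib_left mult_ac)
    qed
    also have "\<dots> = (\<Sum>i\<in>I. \<Sum>k<m. \<Sum>j\<in>I. (- (g\<^sup>2)) ^ k / fact k * (c i * c j * (x i - x j) ^ (2 * k)))"
      by (intro sum.cong refl sum.swap)
    also have "\<dots> = (\<Sum>k<m. \<Sum>i\<in>I. \<Sum>j\<in>I. (- (g\<^sup>2)) ^ k / fact k * (c i * c j * (x i - x j) ^ (2 * k)))"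
      by (rule sum.swap)
    also have "\<dots> = 0"
      using pow by (simp add: sum_distrib_left[symmetric] del: times_divide_eq_left)
    finally show ?thesis .
  qed
  have "\<bar>\<Sum>i\<in>I. \<Sum>j\<in>I. c i * c j * exp (- (g\<^sup>2 * (x i - x j)\<^sup>2))\<bar>
      = \<bar>\<Sum>i\<in>I. \<Sum>j\<in>I. c i * c j * (exp (- (g\<^sup>2 * (x i - x j)\<^sup>2)) - T (x i - x j))\<bar>"
    using T0 by (simp add: right_diff_distrib sum_subtractf)
  also have "\<dots> \<le> (\<Sum>i\<in>I. \<Sum>j\<in>I. \<bar>c i\<bar> * \<bar>c j\<bar> * \<bar>exp (- (g\<^sup>2 * (x i - x j)\<^sup>2)) - T (x i - x j)\<bar>)"
    by (intro order_trans[OF sum_abs] sum_mono) (simp add: abs_mult)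
  also have "\<dots> \<le> (\<Sum>i\<in>I. \<Sum>j\<in>I. \<bar>c i\<bar> * \<bar>c j\<bar> * ((g * h) ^ m)\<^sup>2)"
  proof (intro sum_mono mult_left_mono)
    fix i j assume ij: "i \<in> I" "j \<in> I"
    have "\<bar>exp (- (g\<^sup>2 * (x i - x j)\<^sup>2)) - T (x i - x j)\<bar> \<le> (g\<^sup>2 * (x i - x j)\<^sup>2) ^ m"
      unfolding T_def using \<open>0 < m\<close> by (intro exp_neg_Taylor_remainder) auto
    also have "(g\<^sup>2 * (x i - x j)\<^sup>2) ^ m \<le> (g\<^sup>2 * h\<^sup>2) ^ m"
    proof (rule power_mono)
      show "g\<^sup>2 * (x i - x j)\<^sup>2 \<le> g\<^sup>2 * h\<^sup>2"
        using power_mono[OF dist[OF ij], of 2] by (simp add: mult_left_mono)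
    qed simp
    also have "\<dots> = ((g * h) ^ m)\<^sup>2" by (simp add: power_mult_distrib power_mult[symmetric] mult.commute)
    finally show "\<bar>exp (- (g\<^sup>2 * (x i - x j)\<^sup>2)) - T (x i - x j)\<bar> \<le> ((g * h) ^ m)\<^sup>2" .
  qed auto
  also have "\<dots> = ((\<Sum>i\<in>I. \<bar>c i\<bar>) * (g * h) ^ m)\<^sup>2"
    by (simp add: power2_eq_square[of "_ * _"] sum_product sum_distrib_left sum_distrib_right power2_eq_square mult_ac)
  finally show ?thesis .
qed

abbreviation replace_coord :: "real^'d \<Rightarrow> 'd \<Rightarrow> real \<Rightarrow> real^'d" where
  "replace_coord z l s \<equiv> \<chi> i. if i = l then s else z $ i"

text \<open>The error is a functional with coefficient 1 at \<open>s\<close> and minus the Lagrange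
  weights at the nodes. It annihilates degrees below \<open>card X\<close>, its absolute
  coefficients sum to at most \<open>1 + L\<close>, and on a line parallel to an axis the kernel is
  a one-dimensional Gaussian, so the vanishing-moment bound applies.\<close>

lemma interpolation_error_line:
  fixes f :: "real^'d::finite \<Rightarrow> real"
  assumes f: "f \<in> rkhs (gauss_kernel \<gamma>)" "rkhs_norm (gauss_kernel \<gamma>) f \<le> 1"
    and X: "finite X" "X \<noteq> {}" and g: "0 \<le> \<gamma> l" and h: "0 \<le> h"
    and dist: "\<And>y y'. y \<in> insert s X \<Longrightarrow> y' \<in> insert s X \<Longrightarrow> \<bar>y - y'\<bar> \<le> h"
    and L: "(\<Sum>y\<in>X. \<bar>lagrange_weight X y s\<bar>) \<le> L"
  shows "\<bar>f (replace_coord z l s) - (\<Sum>y\<in>X. lagrange_weight X y s * f (replace_coord z l y))\<bar>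
      \<le> (1 + L) * (\<gamma> l * h) ^ card X"
proof -
  define I where "I = insert s X"
  \<comment> \<open>The point \<open>s\<close> may itself be a node, and then its two coefficients
    must be merged; extending the weights by 0 to \<open>I\<close> lets \<open>c\<close> cover both
    cases.\<close>
  define a where "a y = (if y \<in> X then lagrange_weight X y s else 0)" for y
  define c where "c y = (if y = s then 1 else 0) - a y" for y
  have I: "finite I" using X by (simp add: I_def)
  have sum_c: "(\<Sum>y\<in>I. c y * \<phi> y) = \<phi> s - (\<Sum>y\<in>X. lagrange_weight X y s * \<phi> y)" for \<phi>
  proof -
    have "(\<Sum>y\<in>I. c y * \<phi> y) = (\<Sum>y\<in>I. (if y = s then \<phi> y else 0)) - (\<Sum>y\<in>I. a y * \<phi> y)"
      unfolding sum_subtractf[symmetric] by (intro sum.cong) (auto simp: c_def algebra_simps)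
    also have "(\<Sum>y\<in>I. a y * \<phi> y) = (\<Sum>y\<in>X. lagrange_weight X y s * \<phi> y)"
      using I by (intro sum.mono_neutral_cong_right) (auto simp: I_def a_def)
    finally show ?thesis using I by (simp add: I_def)
  qed
  have abs_c: "(\<Sum>y\<in>I. \<bar>c y\<bar>) \<le> 1 + L"
  proof -
    have "(\<Sum>y\<in>I. \<bar>c y\<bar>) \<le> (\<Sum>y\<in>I. (if y = s then 1 else 0) + \<bar>a y\<bar>)"
      by (intro sum_mono) (auto simp: c_def)
    also have "\<dots> = 1 + (\<Sum>y\<in>I. \<bar>a y\<bar>)" using I by (simp add: sum.distrib I_def)
    also have "(\<Sum>y\<in>I. \<bar>a y\<bar>) = (\<Sum>y\<in>X. \<bar>lagrange_weight X y s\<bar>)"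
      using I by (intro sum.mono_neutral_cong_right) (auto simp: I_def a_def)
    finally show ?thesis using L by simp
  qed
  have ker: "gauss_kernel \<gamma> (replace_coord z l y) (replace_coord z l y') = exp (- ((\<gamma> l)\<^sup>2 * (y - y')\<^sup>2))" for y y'
  proof -
    have "(\<Sum>i\<in>UNIV. (\<gamma> i)\<^sup>2 * (replace_coord z l y $ i - replace_coord z l y' $ i)\<^sup>2)
        = (\<Sum>i\<in>UNIV. if i = l then (\<gamma> i)\<^sup>2 * (y - y')\<^sup>2 else 0)"
      by (intro sum.cong) auto
    then show ?thesis by (simp add: gauss_kernel_def)
  qed
  have "(f (replace_coord z l s) - (\<Sum>y\<in>X. lagrange_weight X y s * f (replace_coord z l y)))\<^sup>2
      = (\<Sum>y\<in>I. c y * f (replace_coord z l y))\<^sup>2"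
    by (simp only: sum_c)
  also have "\<dots> \<le> (rkhs_norm (gauss_kernel \<gamma>) f)\<^sup>2 *
      \<bar>\<Sum>y\<in>I. \<Sum>y'\<in>I. c y * c y' * exp (- ((\<gamma> l)\<^sup>2 * (y - y')\<^sup>2))\<bar>"
    using rkhs_norm_bound_finite[OF f(1) I, of c "replace_coord z l"] unfolding ker .
  also have "\<dots> \<le> 1 * \<bar>\<Sum>y\<in>I. \<Sum>y'\<in>I. c y * c y' * exp (- ((\<gamma> l)\<^sup>2 * (y - y')\<^sup>2))\<bar>"
    using f rkhs_norm_nonneg[OF f(1)] by (intro mult_right_mono) (auto simp: power_le_one)
  also have "\<dots> \<le> ((\<Sum>y\<in>I. \<bar>c y\<bar>) * (\<gamma> l * h) ^ card X)\<^sup>2"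
    unfolding mult_1
  proof (rule gauss_form_vanishing_moments[OF I, where x = "\<lambda>y. y"])
    show "0 < card X" using X by (simp add: card_gt_0_iff)
    show "(\<Sum>y\<in>I. c y * y ^ j) = 0" if "j < card X" for j
      using lagrange_weight_exact[OF X(1) that] by (simp add: sum_c)
  qed (use dist in \<open>auto simp: I_def\<close>)
  also have "\<dots> \<le> ((1 + L) * (\<gamma> l * h) ^ card X)\<^sup>2"
    using abs_c g h by (intro power_mono mult_right_mono) (auto intro!: mult_nonneg_nonneg sum_nonneg)
  finally have *: "(f (replace_coord z l s) - (\<Sum>y\<in>X. lagrange_weight X y s * f (replace_coord z l y)))\<^sup>2
      \<le> ((1 + L) * (\<gamma> l * h) ^ card X)\<^sup>2" .
  have "0 \<le> 1 + L" using abs_c by (meson abs_ge_zero order_trans sum_nonneg)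
  then show ?thesis using g h * by (simp add: abs_le_square_iff[symmetric] abs_mult)
qed

text \<open>Telescoping over coordinates: \<open>Q D\<close> interpolates in the coordinates of
  \<open>D\<close> and keeps the others at their values in \<open>t\<close>. Adding one coordinate
  costs a one-dimensional error \<open>e\<close>, amplified by at most a factor \<open>L\<close> for
  each coordinate already treated.\<close>

lemma tensor_interpolation_error:
  fixes f :: "real^'d::finite \<Rightarrow> real" and w :: "'k \<Rightarrow> real \<Rightarrow> real" and x :: "'k \<Rightarrow> real"
  assumes N: "finite N"
    and err: "\<And>l z. \<bar>f (replace_coord z l (t $ l)) - (\<Sum>i\<in>N. w i (t $ l) * f (replace_coord z l (x i)))\<bar> \<le> e"
    and L: "\<And>l. (\<Sum>i\<in>N. \<bar>w i (t $ l)\<bar>) \<le> L" and "1 \<le> L"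
  shows "\<bar>f t - (\<Sum>k\<in>PiE UNIV (\<lambda>_. N). (\<Prod>l\<in>UNIV. w (k l) (t $ l)) * f (\<chi> l. x (k l)))\<bar>
      \<le> real CARD('d) * L ^ CARD('d) * e"
proof -
  have e: "0 \<le> e" using err by (meson abs_ge_zero order_trans)
  define y where "y D k = (\<chi> l. if l \<in> D then x (k l) else t $ l)" for D :: "'d set" and k :: "'d \<Rightarrow> 'k"
  define Q where "Q D = (\<Sum>k\<in>PiE D (\<lambda>_. N). (\<Prod>l\<in>D. w (k l) (t $ l)) * f (y D k))" for D :: "'d set"
  have "\<bar>f t - Q D\<bar> \<le> real (card D) * L ^ CARD('d) * e" for D :: "'d set"
    using finite[of D]
  proof (induction D rule: finite_induct)
    case empty
    then show ?case by (simp add: Q_def y_def)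
  next
    case (insert l D)
    have "Q (insert l D) = (\<Sum>(i, k)\<in>N \<times> PiE D (\<lambda>_. N).
        (\<Prod>l'\<in>insert l D. w ((k(l := i)) l') (t $ l')) * f (y (insert l D) (k(l := i))))"
      unfolding Q_def PiE_insert_eq
      by (subst sum.reindex[OF inj_combinator[OF insert(2)]]) (simp add: case_prod_unfold)
    also have "\<dots> = (\<Sum>(i, k)\<in>N \<times> PiE D (\<lambda>_. N).
        (\<Prod>l'\<in>D. w (k l') (t $ l')) * (w i (t $ l) * f (replace_coord (y D k) l (x i))))"
    proof (intro sum.cong refl, clarify)
      fix i k
      have "(\<Prod>l'\<in>D. w ((k(l := i)) l') (t $ l')) = (\<Prod>l'\<in>D. w (k l') (t $ l'))"
        using insert(2) by (intro prod.cong) auto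
      moreover have "y (insert l D) (k(l := i)) = replace_coord (y D k) l (x i)"
        by (auto simp: y_def vec_eq_iff)
      ultimately show "(\<Prod>l'\<in>insert l D. w ((k(l := i)) l') (t $ l')) * f (y (insert l D) (k(l := i)))
          = (\<Prod>l'\<in>D. w (k l') (t $ l')) * (w i (t $ l) * f (replace_coord (y D k) l (x i)))"
        using insert by simp
    qed
    also have "\<dots> = (\<Sum>k\<in>PiE D (\<lambda>_. N). (\<Prod>l'\<in>D. w (k l') (t $ l')) *
        (\<Sum>i\<in>N. w i (t $ l) * f (replace_coord (y D k) l (x i))))"
      unfolding sum.cartesian_product[symmetric] sum_distrib_left by (rule sum.swap)
    finally have Qi: "Q (insert l D) = \<dots>" .
    \<comment> \<open>Coordinate \<open>l\<close> has not been treated yet, so the point still has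
      the value \<open>t $ l\<close> there and \<open>err\<close> applies along its line.\<close>
    have "y D k = replace_coord (y D k) l (t $ l)" for k
      using insert(2) by (auto simp: y_def vec_eq_iff)
    then have "\<bar>Q D - Q (insert l D)\<bar> = \<bar>\<Sum>k\<in>PiE D (\<lambda>_. N). (\<Prod>l'\<in>D. w (k l') (t $ l')) *
        (f (replace_coord (y D k) l (t $ l)) - (\<Sum>i\<in>N. w i (t $ l) * f (replace_coord (y D k) l (x i))))\<bar>"
      unfolding Qi by (simp add: Q_def sum_subtractf right_diff_distrib)
    also have "\<dots> \<le> (\<Sum>k\<in>PiE D (\<lambda>_. N). \<bar>\<Prod>l'\<in>D. w (k l') (t $ l')\<bar> * e)"
      by (intro order_trans[OF sum_abs] sum_mono) (simp add: abs_mult mult_left_mono[OF err])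
    \<comment> \<open>The sum of absolute tensor weights factors into one-dimensional sums, each at
      most \<open>L\<close>.\<close>
    also have "\<dots> = (\<Prod>l'\<in>D. \<Sum>i\<in>N. \<bar>w i (t $ l')\<bar>) * e"
      using insert(1) N by (subst prod_sum_PiE) (auto simp: abs_prod sum_distrib_right)
    also have "\<dots> \<le> (\<Prod>l'\<in>D. L) * e"
      using L e by (intro mult_right_mono prod_mono) (auto intro: sum_nonneg)
    also have "\<dots> \<le> L ^ CARD('d) * e"
      using \<open>1 \<le> L\<close> e by (auto intro!: mult_right_mono power_increasing card_mono)
    finally show ?case using insert by (simp add: algebra_simps)
  qed
  from this[of UNIV] show ?thesis by (simp add: Q_def y_def)
qed

subsection \<open>Piecewise interpolation on a grid\<close>

text \<open>The index \<open>(q, j)\<close> stands for node \<open>j\<close> of cell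
  \<open>q\<close>; the cell starts at \<open>q / k - k\<close> and its nodes have spacing
  \<open>1 / (m * k)\<close>.\<close>

definition grid_node :: "nat \<Rightarrow> nat \<Rightarrow> nat \<times> nat \<Rightarrow> real" where
  "grid_node m k i = real (fst i) / real k + real (snd i) / (real m * real k) - real k"

definition cell_nodes :: "nat \<Rightarrow> nat \<Rightarrow> nat \<Rightarrow> real set" where
  "cell_nodes m k q = (\<lambda>j. grid_node m k (q, j)) ` {..<m}"

text \<open>The interval \<open>[-k, k)\<close> splits into \<open>2 * k^2\<close> cells of length
  \<open>1 / k\<close>. For \<open>k = 0\<close> the index set is empty.\<close>

definition grid_index :: "nat \<Rightarrow> nat \<Rightarrow> (nat \<times> nat) set" where
  "grid_index m k = {..<2 * k\<^sup>2} \<times> {..<m}"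

text \<open>The floor selects the half-open cell containing \<open>s\<close>, so each
  \<open>s\<close> uses the nodes of exactly one cell and the interpolant is piecewise
  polynomial.\<close>

definition grid_weight :: "nat \<Rightarrow> nat \<Rightarrow> nat \<times> nat \<Rightarrow> real \<Rightarrow> real" where
  "grid_weight m k i s =
    (if \<lfloor>(s + real k) * real k\<rfloor> = int (fst i)
     then lagrange_weight (cell_nodes m k (fst i)) (grid_node m k i) s else 0)"

lemma finite_grid_index: "finite (grid_index m k)"
  by (simp add: grid_index_def)

lemma inj_on_grid_node:
  assumes "0 < m" "0 < k"
  shows "inj_on (\<lambda>j. grid_node m k (q, j)) A"
  using assms by (auto simp: inj_on_def grid_node_def)

lemma card_cell_nodes:
  assumes "0 < m" "0 < k"
  shows "card (cell_nodes m k q) = m"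
  by (simp add: cell_nodes_def card_image inj_on_grid_node assms)

lemma cell_nodes_subset:
  assumes "0 < m" "0 < k" "y \<in> cell_nodes m k q"
  shows "real q / real k - real k \<le> y" "y \<le> real q / real k - real k + 1 / real k"
proof -
  obtain j where j: "j < m" "y = grid_node m k (q, j)" using assms(3) by (auto simp: cell_nodes_def)
  have "real j / (real m * real k) \<le> 1 / real k" using j assms by (simp add: field_simps)
  then show "real q / real k - real k \<le> y" "y \<le> real q / real k - real k + 1 / real k"
    using j by (auto simp: grid_node_def)
qed

lemma grid_cell_bounds:
  assumes "0 < k" "\<lfloor>(s + real k) * real k\<rfloor> = int q"
  shows "real q / real k - real k \<le> s" "s \<le> real q / real k - real k + 1 / real k"
proof -
  have "real q \<le> (s + real k) * real k" "(s + real k) * real k < real q + 1"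
    using assms(2) by linarith+
  then have "real q / real k \<le> s + real k" "s + real k < (real q + 1) / real k"
    using assms(1) by (simp_all add: field_simps)
  then show "real q / real k - real k \<le> s" "s \<le> real q / real k - real k + 1 / real k"
    by (simp_all add: add_divide_distrib)
qed

text \<open>Within one cell the numerators are at most \<open>1 / k\<close> and distinct nodes are
  at least \<open>1 / (m * k)\<close> apart, so each of at most \<open>m\<close> factors is at most
  \<open>m\<close>. The bound does not depend on \<open>k\<close>.\<close>

lemma abs_grid_weight_le:
  assumes "0 < m" "0 < k" "snd i < m"
  shows "\<bar>grid_weight m k i s\<bar> \<le> real m ^ m"
proof (cases "\<lfloor>(s + real k) * real k\<rfloor> = int (fst i)")
  case True
  define q X x where "q = fst i" and "X = cell_nodes m k q" and "x = grid_node m k i"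
  have ratio: "\<bar>(s - y) / (x - y)\<bar> \<le> real m" if y: "y \<in> X - {x}" for y
  proof -
    have "\<bar>s - y\<bar> \<le> 1 / real k"
      using cell_nodes_subset[OF assms(1,2), of y q] grid_cell_bounds[OF assms(2) True] y
      unfolding X_def q_def by auto
    obtain j where j: "y = grid_node m k (q, j)" using y by (auto simp: X_def cell_nodes_def)
    then have "j \<noteq> snd i" using y by (auto simp: x_def q_def)
    have "x - y = (real (snd i) - real j) / (real m * real k)"
      by (simp add: j x_def grid_node_def q_def diff_divide_distrib)
    moreover have "1 \<le> \<bar>real (snd i) - real j\<bar>" using \<open>j \<noteq> snd i\<close> by linarith
    ultimately have "1 / (real m * real k) \<le> \<bar>x - y\<bar>"
      by (simp add: abs_divide divide_right_mono)
    then have "\<bar>s - y\<bar> / \<bar>x - y\<bar> \<le> (1 / real k) / (1 / (real m * real k))"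
      using \<open>\<bar>s - y\<bar> \<le> 1 / real k\<close> assms by (intro frac_le) auto
    then show ?thesis using assms by (simp add: abs_divide)
  qed
  have "\<bar>grid_weight m k i s\<bar> = (\<Prod>y\<in>X - {x}. \<bar>(s - y) / (x - y)\<bar>)"
    using True by (simp add: grid_weight_def lagrange_weight_def X_def x_def q_def abs_prod)
  also have "\<dots> \<le> (\<Prod>y\<in>X - {x}. real m)" using ratio by (intro prod_mono) auto
  also have "\<dots> = real m ^ card (X - {x})" by simp
  also have "\<dots> \<le> real m ^ m"
    using assms card_cell_nodes[OF assms(1,2), of q] card_Diff1_le[of X x]
    by (intro power_increasing) (auto simp: X_def)
  finally show ?thesis .
qed (simp add: grid_weight_def)

lemma grid_weight_outside:
  assumes "0 < k" "i \<in> grid_index m k" "s < - real k \<or> real k \<le> s"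
  shows "grid_weight m k i s = 0"
proof (rule ccontr)
  assume "grid_weight m k i s \<noteq> 0"
  then have fl: "\<lfloor>(s + real k) * real k\<rfloor> = int (fst i)" by (auto simp: grid_weight_def split: if_splits)
  have "fst i < 2 * k\<^sup>2" using assms(2) by (auto simp: grid_index_def)
  then have "real (fst i + 1) \<le> real (2 * k\<^sup>2)" by (simp only: of_nat_le_iff)
  then have "real (fst i) + 1 \<le> 2 * (real k)\<^sup>2" by simp
  moreover have "0 \<le> (s + real k) * real k" "(s + real k) * real k < real (fst i) + 1"
    using fl by linarith+
  ultimately have "0 \<le> (s + real k) * real k" "(s + real k) * real k < (2 * real k) * real k"
    by (auto simp: power2_eq_square)
  then show False using assms(1,3) by (auto simp: zero_le_mult_iff)
qed

text \<open>Only the cell containing \<open>s\<close> contributes. Stating this for any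
  \<open>F\<close> supported on that cell covers sums of absolute weights as well as the interpolant
  itself.\<close>

lemma grid_weight_sum:
  assumes "0 < k" "- real k \<le> s" "s < real k"
  obtains q where "\<lfloor>(s + real k) * real k\<rfloor> = int q"
    "\<And>F. (\<And>i. fst i \<noteq> q \<Longrightarrow> F i = 0) \<Longrightarrow> (\<Sum>i\<in>grid_index m k. F i) = (\<Sum>j<m. F (q, j) :: real)"
proof
  define q where "q = nat \<lfloor>(s + real k) * real k\<rfloor>"
  have "0 \<le> (s + real k) * real k" using assms by simp
  then show q: "\<lfloor>(s + real k) * real k\<rfloor> = int q" by (simp add: q_def)
  have "(s + real k) * real k < (2 * real k) * real k"
    using assms by (intro mult_strict_right_mono) auto
  moreover have "real q \<le> (s + real k) * real k" using q by linarith
  ultimately have "real q < real (2 * k\<^sup>2)" by (simp add: power2_eq_square)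
  then have "q < 2 * k\<^sup>2" by (simp only: of_nat_less_iff)
  fix F :: "nat \<times> nat \<Rightarrow> real" assume F: "\<And>i. fst i \<noteq> q \<Longrightarrow> F i = 0"
  have "(\<Sum>i\<in>grid_index m k. F i) = (\<Sum>q'<2 * k\<^sup>2. \<Sum>j<m. F (q', j))"
    by (simp add: grid_index_def sum.cartesian_product)
  also have "\<dots> = (\<Sum>q'<2 * k\<^sup>2. if q' = q then \<Sum>j<m. F (q, j) else 0)"
    using F by (intro sum.cong) auto
  finally show "(\<Sum>i\<in>grid_index m k. F i) = (\<Sum>j<m. F (q, j))" using \<open>q < 2 * k\<^sup>2\<close> by simp
qed

lemma sum_abs_grid_weight_le:
  assumes "0 < m" "0 < k" "- real k \<le> s" "s < real k"
  shows "(\<Sum>i\<in>grid_index m k. \<bar>grid_weight m k i s\<bar>) \<le> real m * real m ^ m"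
proof -
  obtain q where q: "\<lfloor>(s + real k) * real k\<rfloor> = int q"
    "\<And>F. (\<And>i. fst i \<noteq> q \<Longrightarrow> F i = 0) \<Longrightarrow> (\<Sum>i\<in>grid_index m k. F i) = (\<Sum>j<m. F (q, j) :: real)"
    using grid_weight_sum[OF assms(2-4)] by metis
  have "(\<Sum>i\<in>grid_index m k. \<bar>grid_weight m k i s\<bar>) = (\<Sum>j<m. \<bar>grid_weight m k (q, j) s\<bar>)"
    using q(1) by (intro q(2)) (auto simp: grid_weight_def)
  also have "\<dots> \<le> (\<Sum>j<m. real m ^ m)" using assms by (intro sum_mono abs_grid_weight_le) auto
  finally show ?thesis by simp
qed

text \<open>Only one cell is active, so this is Lagrange interpolation at \<open>m\<close> nodes;
  these and \<open>s\<close> lie in an interval of length \<open>1 / k\<close>, which serves as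
  \<open>h\<close>.\<close>

lemma grid_line_error:
  fixes f :: "real^'d::finite \<Rightarrow> real"
  assumes f: "f \<in> rkhs (gauss_kernel \<gamma>)" "rkhs_norm (gauss_kernel \<gamma>) f \<le> 1"
    and g: "0 \<le> \<gamma> l" and mk: "0 < m" "0 < k" and s: "- real k \<le> s" "s < real k"
  shows "\<bar>f (replace_coord z l s) - (\<Sum>i\<in>grid_index m k. grid_weight m k i s * f (replace_coord z l (grid_node m k i)))\<bar>
      \<le> (1 + real m * real m ^ m) * (\<gamma> l / real k) ^ m"
proof -
  obtain q where q: "\<lfloor>(s + real k) * real k\<rfloor> = int q"
    "\<And>F. (\<And>i. fst i \<noteq> q \<Longrightarrow> F i = 0) \<Longrightarrow> (\<Sum>i\<in>grid_index m k. F i) = (\<Sum>j<m. F (q, j) :: real)"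
    using grid_weight_sum[OF mk(2) s] by metis
  define X where "X = cell_nodes m k q"
  have reidx: "(\<Sum>j<m. \<phi> (grid_node m k (q, j))) = (\<Sum>y\<in>X. \<phi> y)" for \<phi> :: "real \<Rightarrow> real"
    by (simp add: X_def cell_nodes_def sum.reindex inj_on_grid_node mk)
  have "(\<Sum>i\<in>grid_index m k. grid_weight m k i s * f (replace_coord z l (grid_node m k i)))
      = (\<Sum>j<m. grid_weight m k (q, j) s * f (replace_coord z l (grid_node m k (q, j))))"
    using q(1) by (intro q(2)) (auto simp: grid_weight_def)
  also have "\<dots> = (\<Sum>y\<in>X. lagrange_weight X y s * f (replace_coord z l y))"
    unfolding reidx[symmetric] by (simp add: grid_weight_def q(1) X_def)
  finally have sum1: "(\<Sum>i\<in>grid_index m k. grid_weight m k i s * f (replace_coord z l (grid_node m k i))) = \<dots>" .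
  have "(\<Sum>i\<in>grid_index m k. \<bar>grid_weight m k i s\<bar>) = (\<Sum>j<m. \<bar>grid_weight m k (q, j) s\<bar>)"
    using q(1) by (intro q(2)) (auto simp: grid_weight_def)
  also have "\<dots> = (\<Sum>y\<in>X. \<bar>lagrange_weight X y s\<bar>)"
    unfolding reidx[symmetric] by (simp add: grid_weight_def q(1) X_def)
  finally have L: "(\<Sum>y\<in>X. \<bar>lagrange_weight X y s\<bar>) \<le> real m * real m ^ m"
    using sum_abs_grid_weight_le[OF mk s] by simp
  have X: "finite X" "X \<noteq> {}" "card X = m"
    using mk card_cell_nodes[OF mk] by (auto simp: X_def cell_nodes_def)
  have "\<bar>f (replace_coord z l s) - (\<Sum>y\<in>X. lagrange_weight X y s * f (replace_coord z l y))\<bar>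
      \<le> (1 + real m * real m ^ m) * (\<gamma> l * (1 / real k)) ^ card X"
  proof (rule interpolation_error_line[OF f X(1,2) g _ _ L])
    show "\<bar>y - y'\<bar> \<le> 1 / real k" if "y \<in> insert s X" "y' \<in> insert s X" for y y'
    proof -
      have "real q / real k - real k \<le> y \<and> y \<le> real q / real k - real k + 1 / real k" if "y \<in> insert s X" for y
        using that cell_nodes_subset[OF mk, of y q] grid_cell_bounds[OF mk(2) q(1)] by (auto simp: X_def)
      from this[OF that(1)] this[OF that(2)] show ?thesis by auto
    qed
  qed simp
  then show ?thesis by (simp add: sum1 X(3))
qed

text \<open>One formula serves on the whole space: the weights vanish outside the box, so the
  approximation is 0 there without a case distinction.\<close>

definition grid_approx :: "nat \<Rightarrow> nat \<Rightarrow> (real^'d::finite \<Rightarrow> real) \<Rightarrow> real^'d \<Rightarrow> real" where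
  "grid_approx m k f t = (\<Sum>i\<in>PiE UNIV (\<lambda>_. grid_index m k).
     (\<Prod>l\<in>UNIV. grid_weight m k (i l) (t $ l)) * f (\<chi> l. grid_node m k (i l)))"

lemma grid_approx_error:
  fixes f :: "real^'d::finite \<Rightarrow> real"
  assumes f: "f \<in> rkhs (gauss_kernel \<gamma>)" "rkhs_norm (gauss_kernel \<gamma>) f \<le> 1"
    and g: "\<And>l. 0 \<le> \<gamma> l" "\<And>l. \<gamma> l \<le> G" and mk: "0 < m" "0 < k"
    and t: "\<And>l. - real k \<le> t $ l" "\<And>l. t $ l < real k"
  shows "\<bar>f t - grid_approx m k f t\<bar>
      \<le> real CARD('d) * (real m * real m ^ m) ^ CARD('d) * ((1 + real m * real m ^ m) * (G / real k) ^ m)"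
  unfolding grid_approx_def
proof (rule tensor_interpolation_error[OF finite_grid_index])
  fix l z
  have "\<bar>f (replace_coord z l (t $ l)) - (\<Sum>i\<in>grid_index m k. grid_weight m k i (t $ l) * f (replace_coord z l (grid_node m k i)))\<bar>
      \<le> (1 + real m * real m ^ m) * (\<gamma> l / real k) ^ m"
    by (rule grid_line_error[OF f g(1) mk t])
  also have "\<dots> \<le> (1 + real m * real m ^ m) * (G / real k) ^ m"
    using g by (intro mult_left_mono power_mono divide_right_mono) auto
  finally show "\<bar>f (replace_coord z l (t $ l)) - (\<Sum>i\<in>grid_index m k. grid_weight m k i (t $ l) * f (replace_coord z l (grid_node m k i)))\<bar>
      \<le> (1 + real m * real m ^ m) * (G / real k) ^ m" .
next
  show "1 \<le> real m * real m ^ m"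
    using mk one_le_power[of "real m" "Suc m"] by simp
qed (rule sum_abs_grid_weight_le[OF mk t])

lemma grid_approx_outside:
  fixes t :: "real^'d::finite"
  assumes "0 < k" "t $ l < - real k \<or> real k \<le> t $ l"
  shows "grid_approx m k f t = 0"
  unfolding grid_approx_def
proof (intro sum.neutral ballI)
  fix i :: "'d \<Rightarrow> nat \<times> nat" assume "i \<in> UNIV \<rightarrow>\<^sub>E grid_index m k"
  then have "grid_weight m k (i l) (t $ l) = 0"
    using assms by (intro grid_weight_outside) auto
  then have "(\<Prod>l\<in>UNIV. grid_weight m k (i l) (t $ l)) = 0" by (auto intro: prod_zero)
  then show "(\<Prod>l\<in>UNIV. grid_weight m k (i l) (t $ l)) * f (\<chi> l. grid_node m k (i l)) = 0" by simp
qed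

subsection \<open>Error in the weighted norm\<close>

text \<open>\<open>rho\<close> with the exponent halved: still integrable, while the other half of
  the exponent remains available as a decay factor far from the origin.\<close>

definition gauss_dom :: "real^'d::finite \<Rightarrow> real" where
  "gauss_dom t = pi powr (- real CARD('d) / 2) * exp (- (norm t)\<^sup>2 / 2)"

text \<open>The squared norm is a sum over coordinates, so the integral factors into one-dimensional
  ones, finite as multiples of the standard normal integral.\<close>

lemma nn_integral_gauss_dom_finite:
  "(\<integral>\<^sup>+ t. ennreal (gauss_dom (t::real^'d::finite)) \<partial>lborel) < \<infinity>"
proof -
  have "integrable lborel (\<lambda>x. sqrt (2 * pi) * normal_density 0 1 x)"
    by (intro integrable_mult_right integrable_normal_density) simp
  then have "integrable lborel (\<lambda>x::real. exp (- x\<^sup>2 / 2))"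
    by (simp add: normal_density_def)
  then have fin: "(\<integral>\<^sup>+ x. ennreal (exp (- x\<^sup>2 / 2)) \<partial>lborel) < \<infinity>"
    by (subst nn_integral_eq_integral) auto
  have dom: "ennreal (gauss_dom t) = ennreal (pi powr (- real CARD('d) / 2)) *
      (\<Prod>b\<in>Basis. ennreal (exp (- (t \<bullet> b)\<^sup>2 / 2)))" for t :: "real^'d"
  proof -
    have "(norm t)\<^sup>2 = (\<Sum>b\<in>Basis. (t \<bullet> b)\<^sup>2)"
      unfolding power2_norm_eq_inner by (subst euclidean_inner) (simp add: power2_eq_square)
    then have "- (norm t)\<^sup>2 / 2 = (\<Sum>b\<in>Basis. - (t \<bullet> b)\<^sup>2 / 2)"
      by (simp add: sum_negf sum_divide_distrib)
    then have "exp (- (norm t)\<^sup>2 / 2) = (\<Prod>b\<in>Basis. exp (- (t \<bullet> b)\<^sup>2 / 2))"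
      by (simp only: exp_sum[OF finite_Basis])
    then show ?thesis by (simp add: gauss_dom_def ennreal_mult prod_ennreal prod_nonneg)
  qed
  have "(\<integral>\<^sup>+ t. ennreal (gauss_dom (t::real^'d)) \<partial>lborel) = ennreal (pi powr (- real CARD('d) / 2)) *
      (\<integral>\<^sup>+ t. (\<Prod>b\<in>(Basis::(real^'d) set). ennreal (exp (- (t \<bullet> b)\<^sup>2 / 2))) \<partial>lborel)"
    unfolding dom by (rule nn_integral_cmult) measurable
  also have "\<dots> = ennreal (pi powr (- real CARD('d) / 2)) *
      (\<Prod>b\<in>(Basis::(real^'d) set). \<integral>\<^sup>+ x. ennreal (exp (- x\<^sup>2 / 2)) \<partial>lborel)"
    by (subst nn_integral_lborel_prod[where f = "\<lambda>_ x. ennreal (exp (- x\<^sup>2 / 2))"]) auto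
  also have "\<dots> < \<infinity>"
    using fin by (auto simp: ennreal_mult_less_top power_less_top_ennreal)
  finally show ?thesis .
qed

definition gauss_dom_mass :: "'d::finite itself \<Rightarrow> real" where
  "gauss_dom_mass _ = enn2real (\<integral>\<^sup>+ t. ennreal (gauss_dom (t::real^'d)) \<partial>lborel)"

lemma nn_integral_le_gauss_dom:
  fixes g :: "real^'d::finite \<Rightarrow> real"
  assumes "0 \<le> B" "\<And>t. g t \<le> B * gauss_dom t"
  shows "(\<integral>\<^sup>+ t. ennreal (g t) \<partial>lborel) \<le> ennreal (B * gauss_dom_mass TYPE('d))"
proof -
  have [measurable]: "gauss_dom \<in> borel_measurable (lborel :: (real^'d) measure)"
    unfolding gauss_dom_def[abs_def] by measurable
  have "(\<integral>\<^sup>+ t. ennreal (g t) \<partial>lborel) \<le> (\<integral>\<^sup>+ t. ennreal B * ennreal (gauss_dom (t::real^'d)) \<partial>lborel)"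
    using assms by (intro nn_integral_mono) (auto simp: ennreal_mult'[symmetric] intro: ennreal_leI)
  also have "\<dots> = ennreal B * (\<integral>\<^sup>+ t. ennreal (gauss_dom (t::real^'d)) \<partial>lborel)"
    by (rule nn_integral_cmult) measurable
  also have "\<dots> = ennreal (B * gauss_dom_mass TYPE('d))"
    using nn_integral_gauss_dom_finite[where 'd = 'd] assms(1)
    by (simp add: gauss_dom_mass_def ennreal_mult)
  finally show ?thesis .
qed

text \<open>A pointwise comparison with \<open>gauss_dom\<close> lets a single constant
  \<open>B\<close> handle the box and its complement together.\<close>

lemma L2_rho_norm_le:
  fixes g :: "real^'d::finite \<Rightarrow> real"
  assumes "0 \<le> B" "\<And>t. (g t)\<^sup>2 * rho t \<le> B * gauss_dom t"
  shows "L2_rho_norm g \<le> ennreal (sqrt (B * gauss_dom_mass TYPE('d)))"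
proof -
  define x where "x = (\<integral>\<^sup>+ t. ennreal ((g t)\<^sup>2 * rho t) \<partial>lborel)"
  have x: "x \<le> ennreal (B * gauss_dom_mass TYPE('d))"
    unfolding x_def by (rule nn_integral_le_gauss_dom[OF assms])
  have "0 \<le> B * gauss_dom_mass TYPE('d)" using assms(1) by (simp add: gauss_dom_mass_def)
  then have "enn2real x \<le> B * gauss_dom_mass TYPE('d)"
    using enn2real_mono[OF x] by simp
  moreover have "x \<noteq> \<infinity>" using x by (auto simp: top_unique)
  ultimately show ?thesis
    by (simp add: L2_rho_norm_def enn_sqrt_def x_def[symmetric] ennreal_leI)
qed

lemma rho_le_gauss_dom: "rho t \<le> gauss_dom t"
  by (simp add: rho_def gauss_dom_def)

lemma rho_le_gauss_dom_far:
  assumes "0 \<le> R" "R \<le> norm t"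
  shows "rho t \<le> exp (- R\<^sup>2 / 2) * gauss_dom t"
proof -
  have "R\<^sup>2 \<le> (norm t)\<^sup>2" using assms by (intro power_mono) auto
  then have "exp (- (norm t)\<^sup>2) \<le> exp (- R\<^sup>2 / 2) * exp (- (norm t)\<^sup>2 / 2)"
    unfolding exp_add[symmetric] by simp
  then show ?thesis by (simp add: rho_def gauss_dom_def mult.left_commute mult_left_mono)
qed

lemma rho_nonneg: "0 \<le> rho t"
  by (simp add: rho_def)

lemma gauss_dom_nonneg: "0 \<le> gauss_dom t"
  by (simp add: gauss_dom_def)

lemma grid_weight_prod_L2_rho:
  assumes "0 < m" "0 < k" "\<And>l. snd (i l) < m"
  shows "(\<lambda>t::real^'d::finite. \<Prod>l\<in>UNIV. grid_weight m k (i l) (t $ l)) \<in> L2_rho"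
proof -
  have gw[measurable]: "grid_weight m k j \<in> borel_measurable borel" for j
    unfolding grid_weight_def lagrange_weight_def by measurable
  have meas: "(\<lambda>t::real^'d. \<Prod>l\<in>UNIV. grid_weight m k (i l) (t $ l)) \<in> borel_measurable lborel"
    by (auto intro!: borel_measurable_prod measurable_compose[OF _ gw] borel_measurable_continuous_onI continuous_intros)
  define W where "W = (real m ^ m) ^ CARD('d)"
  have "(\<integral>\<^sup>+ t. ennreal ((\<Prod>l\<in>UNIV. grid_weight m k (i l) (t $ l))\<^sup>2 * rho (t::real^'d)) \<partial>lborel)
      \<le> ennreal (W\<^sup>2 * gauss_dom_mass TYPE('d))"
  proof (rule nn_integral_le_gauss_dom)
    fix t :: "real^'d"
    have "\<bar>\<Prod>l\<in>UNIV. grid_weight m k (i l) (t $ l)\<bar> \<le> (\<Prod>l\<in>(UNIV::'d set). real m ^ m)"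
      unfolding abs_prod using assms by (intro prod_mono) (auto intro: abs_grid_weight_le)
    then have "(\<Prod>l\<in>UNIV. grid_weight m k (i l) (t $ l))\<^sup>2 \<le> W\<^sup>2"
      by (simp add: W_def abs_le_square_iff[symmetric])
    then show "(\<Prod>l\<in>UNIV. grid_weight m k (i l) (t $ l))\<^sup>2 * rho t \<le> W\<^sup>2 * gauss_dom t"
      using rho_le_gauss_dom rho_nonneg by (intro mult_mono) auto
  qed simp
  also have "\<dots> < \<infinity>" by simp
  finally show ?thesis using meas by (simp add: L2_rho_def)
qed

section \<open>Minimal errors and the choice of the grid\<close>

lemma e_wor_std_le:
  fixes \<gamma> :: "'d::finite \<Rightarrow> real"
  assumes S: "finite S" "card S \<le> n" and a: "\<And>i. i \<in> S \<Longrightarrow> a i \<in> L2_rho"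
    and err: "\<And>f. f \<in> rkhs (gauss_kernel \<gamma>) \<Longrightarrow> rkhs_norm (gauss_kernel \<gamma>) f \<le> 1 \<Longrightarrow>
      L2_rho_norm (\<lambda>t. f t - (\<Sum>i\<in>S. a i t * f (p i))) \<le> E"
  shows "e_wor_std \<gamma> n \<le> E"
proof -
  obtain b where b: "bij_betw b {..<card S} S"
    using ex_bij_betw_nat_finite[OF S(1)] atLeast0LessThan by metis
  define L where "L j f = f (p (b j))" for j :: nat and f :: "real^'d \<Rightarrow> real"
  \<comment> \<open>An algorithm with fewer than \<open>n\<close> points is padded with zero
    coefficients; the surplus functionals are still point evaluations.\<close>
  define a' where "a' j = (if j < card S then a (b j) else (\<lambda>_. 0))" for j
  have bS: "b j \<in> S" if "j < card S" for j using b that by (auto simp: bij_betw_def)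
  have La: "\<forall>j<n. L j \<in> Lambda_std \<and> a' j \<in> L2_rho"
    using a bS by (auto simp: L_def Lambda_std_def a'_def L2_rho_def)
  have sum: "(\<Sum>j<n. L j f * a' j t) = (\<Sum>i\<in>S. a i t * f (p i))" for f t
  proof -
    have "(\<Sum>j<n. L j f * a' j t) = (\<Sum>j<card S. a (b j) t * f (p (b j)))"
      using S(2) by (intro sum.mono_neutral_cong_right) (auto simp: a'_def L_def)
    then show ?thesis using sum.reindex_bij_betw[OF b, of "\<lambda>i. a i t * f (p i)"] by simp
  qed
  have "e_wor_std \<gamma> n \<le> wce \<gamma> n L a'"
    unfolding e_wor_std_def min_wce_def using La by (intro INF_lower2[of "(L, a')"]) auto
  also have "\<dots> \<le> E" unfolding wce_def sum using err by (intro SUP_least) auto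
  finally show ?thesis .
qed

text \<open>\<open>x ^ m / fact m\<close> is a single term of the series of \<open>exp x\<close>.
  This turns the Gaussian tail into a power of \<open>k\<close>.\<close>

lemma exp_neg_le_power:
  fixes x :: real
  assumes "0 < x"
  shows "exp (- x) \<le> fact m / x ^ m"
proof -
  obtain t where "exp x = (\<Sum>j<Suc m. x ^ j / fact j) + exp t / fact (Suc m) * x ^ Suc m"
    using Maclaurin_exp_le[of x "Suc m"] by blast
  moreover have "x ^ m / fact m \<le> (\<Sum>j<Suc m. x ^ j / fact j)"
    using assms by (simp add: sum_nonneg)
  moreover have "0 \<le> exp t / fact (Suc m) * x ^ Suc m" using assms by (intro mult_nonneg_nonneg) auto
  ultimately have "x ^ m / fact m \<le> exp x" by linarith
  then show ?thesis using assms by (simp add: exp_minus field_simps)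
qed

text \<open>Dividing by a power of \<open>k + 1\<close> rather than \<open>k\<close> admits
  \<open>k = 0\<close>, the zero algorithm, which serves those \<open>n\<close> that are too small
  for any real grid.\<close>

lemma e_wor_std_grid:
  fixes \<gamma> :: "'d::finite \<Rightarrow> real"
  assumes "\<And>l. 0 \<le> \<gamma> l" "0 < m"
  obtains C where "0 \<le> C" "\<And>k n. (2 * k\<^sup>2 * m) ^ CARD('d) \<le> n \<Longrightarrow> e_wor_std \<gamma> n \<le> ennreal (C / real (k + 1) ^ m)"
proof
  define G where "G = (\<Sum>l\<in>UNIV. \<gamma> l)"
  have G: "\<gamma> l \<le> G" for l unfolding G_def by (rule member_le_sum) (auto simp: assms)
  define D where "D = real CARD('d) * (real m * real m ^ m) ^ CARD('d) * ((1 + real m * real m ^ m) * G ^ m)"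
  \<comment> \<open>\<open>D\<close> comes from the error in the box, \<open>fact m * 2 ^ m\<close>
    from the tail outside it, and \<open>4 ^ m\<close> pays for replacing \<open>k\<close> by
    \<open>k + 1\<close>.\<close>
  define A where "A = (D\<^sup>2 + fact m * 2 ^ m) * 4 ^ m"
  define J where "J = gauss_dom_mass TYPE('d)"
  have J: "0 \<le> J" by (simp add: J_def gauss_dom_mass_def)
  have A: "0 \<le> A" by (simp add: A_def)
  show "0 \<le> sqrt (A * J)" using A J by simp
  fix k n assume n: "(2 * k\<^sup>2 * m) ^ CARD('d) \<le> n"
  define S where "S = PiE (UNIV::'d set) (\<lambda>_. grid_index m k)"
  have "card S = (2 * k\<^sup>2 * m) ^ CARD('d)"
    by (simp add: S_def card_PiE grid_index_def)
  then have S: "finite S" "card S \<le> n" using n by (auto simp: S_def finite_grid_index intro!: finite_PiE)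
  define E where "E = ennreal (sqrt (A / real (k + 1) ^ (2 * m) * J))"
  have "e_wor_std \<gamma> n \<le> E"
  proof (rule e_wor_std_le[OF S, where a = "\<lambda>i t. \<Prod>l\<in>UNIV. grid_weight m k (i l) (t $ l)"
        and p = "\<lambda>i. \<chi> l. grid_node m k (i l)"])
    fix i assume i: "i \<in> S"
    \<comment> \<open>Membership in \<open>S\<close> excludes \<open>k = 0\<close>, where the grid
      is empty.\<close>
    then have "i undefined \<in> grid_index m k" by (auto simp: S_def)
    then have "0 < k" by (auto simp: grid_index_def intro: gr0I)
    with i show "(\<lambda>t. \<Prod>l\<in>UNIV. grid_weight m k (i l) (t $ l)) \<in> L2_rho"
      using assms(2) by (intro grid_weight_prod_L2_rho) (auto simp: S_def grid_index_def PiE_iff mem_Times_iff)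
  next
    fix f :: "real^'d \<Rightarrow> real"
    assume f: "f \<in> rkhs (gauss_kernel \<gamma>)" "rkhs_norm (gauss_kernel \<gamma>) f \<le> 1"
    have f1: "(f t)\<^sup>2 \<le> 1" for t
      using abs_eval_le_rkhs_norm[OF f(1), of t] f(2) by (simp add: abs_square_le_1)
    have "(f t - grid_approx m k f t)\<^sup>2 * rho t \<le> A / real (k + 1) ^ (2 * m) * gauss_dom t" for t
    proof (cases "k = 0")
      case True
      then have "grid_approx m k f t = 0"
        by (simp add: grid_approx_def grid_index_def PiE_eq_empty_iff)
      moreover have "1 \<le> A"
      proof -
        have "1 * 1 * 1 \<le> fact m * 2 ^ m * (4 ^ m :: real)"
          by (intro mult_mono one_le_power fact_ge_1) auto
        also have "\<dots> \<le> A" by (simp add: A_def distrib_right)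
        finally show ?thesis by simp
      qed
      ultimately show ?thesis
        using True f1[of t] rho_le_gauss_dom[of t] rho_nonneg[of t] by (auto intro!: mult_mono)
    next
      case False
      then have k: "0 < k" by simp
      \<comment> \<open>Uses \<open>k + 1 \<le> 2 * k\<close>, valid for
        \<open>k \<ge> 1\<close>.\<close>
      have kpow: "1 / real k ^ (2 * m) \<le> 4 ^ m / real (k + 1) ^ (2 * m)"
      proof -
        have "real (k + 1) ^ (2 * m) \<le> (2 * real k) ^ (2 * m)" using k by (intro power_mono) auto
        also have "\<dots> = 4 ^ m * real k ^ (2 * m)" by (simp add: power_mult_distrib power_mult)
        finally show ?thesis using k by (simp add: field_simps)
      qed
      have "(f t - grid_approx m k f t)\<^sup>2 * rho t \<le> (D\<^sup>2 + fact m * 2 ^ m) * (1 / real k ^ (2 * m)) * gauss_dom t"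
      proof (cases "\<forall>l. - real k \<le> t $ l \<and> t $ l < real k")
        case True
        have "\<bar>f t - grid_approx m k f t\<bar> \<le> D * (1 / real k ^ m)"
          using grid_approx_error[OF f assms(1) G assms(2) k, of t] True
          by (simp add: D_def power_divide)
        then have "(f t - grid_approx m k f t)\<^sup>2 \<le> (D * (1 / real k ^ m))\<^sup>2"
          by (metis abs_ge_zero power2_abs power_mono)
        also have "\<dots> = D\<^sup>2 * (1 / real k ^ (2 * m))"
          by (simp add: power_mult_distrib power_divide power_mult[symmetric] mult.commute)
        also have "\<dots> \<le> (D\<^sup>2 + fact m * 2 ^ m) * (1 / real k ^ (2 * m))"
          by (intro mult_right_mono) auto
        finally show ?thesis using rho_le_gauss_dom[of t] rho_nonneg[of t] by (intro mult_mono) auto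
      next
        case False
        then obtain l where l: "t $ l < - real k \<or> real k \<le> t $ l" by (metis not_less)
        then have "real k \<le> norm t" using component_le_norm_cart[of t l] by auto
        have "exp (- (real k)\<^sup>2 / 2) \<le> fact m / ((real k)\<^sup>2 / 2) ^ m"
          using exp_neg_le_power[of "(real k)\<^sup>2 / 2" m] k by simp
        also have "\<dots> = fact m * 2 ^ m * (1 / real k ^ (2 * m))"
          by (simp add: power_divide power_mult[symmetric])
        also have "\<dots> \<le> (D\<^sup>2 + fact m * 2 ^ m) * (1 / real k ^ (2 * m))"
          by (intro mult_right_mono) auto
        finally have ex: "exp (- (real k)\<^sup>2 / 2) \<le> (D\<^sup>2 + fact m * 2 ^ m) * (1 / real k ^ (2 * m))" .
        have "(f t - grid_approx m k f t)\<^sup>2 * rho t \<le> 1 * rho t"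
          using f1[of t] rho_nonneg[of t] by (intro mult_right_mono) (simp_all add: grid_approx_outside[OF k l])
        also have "\<dots> \<le> exp (- (real k)\<^sup>2 / 2) * gauss_dom t"
          using rho_le_gauss_dom_far[OF _ \<open>real k \<le> norm t\<close>] by simp
        also have "\<dots> \<le> (D\<^sup>2 + fact m * 2 ^ m) * (1 / real k ^ (2 * m)) * gauss_dom t"
          using ex gauss_dom_nonneg by (rule mult_right_mono)
        finally show ?thesis .
      qed
      also have "\<dots> \<le> (D\<^sup>2 + fact m * 2 ^ m) * (4 ^ m / real (k + 1) ^ (2 * m)) * gauss_dom t"
        using kpow gauss_dom_nonneg by (intro mult_right_mono mult_left_mono) auto
      finally show ?thesis by (simp add: A_def)
    qed
    then show "L2_rho_norm (\<lambda>t. f t - (\<Sum>i\<in>S. (\<Prod>l\<in>UNIV. grid_weight m k (i l) (t $ l)) *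
        f (\<chi> l. grid_node m k (i l)))) \<le> E"
      using A unfolding E_def J_def grid_approx_def S_def by (intro L2_rho_norm_le) auto
  qed
  also have "E = ennreal (sqrt (A * J) / real (k + 1) ^ m)"
    by (simp add: E_def real_sqrt_divide real_sqrt_mult power_even_eq)
  finally show "e_wor_std \<gamma> n \<le> ennreal (sqrt (A * J) / real (k + 1) ^ m)" .
qed

theorem theorem1:
  fixes \<gamma> :: "'d::finite \<Rightarrow> real" and p :: real
  assumes "\<forall>l. \<gamma> l > 0"
    and "p > 0"
  shows "\<exists>C::real. \<forall>n::nat. n \<ge> 1 \<longrightarrow>
           e_wor_all \<gamma> n \<le> e_wor_std \<gamma> n \<and> e_wor_std \<gamma> n \<le> ennreal (C * real n powr (- p))"
proof -
  define d where "d = CARD('d)"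
  have d: "0 < d" by (simp add: d_def)
  \<comment> \<open>With about \<open>(2 * m * k^2) ^ d\<close> points and error of order
    \<open>k powr (- m)\<close>, the rate is \<open>m / (2 * d)\<close>, which has to reach
    \<open>p\<close>.\<close>
  define m where "m = nat \<lceil>2 * real d * p\<rceil>"
  have "0 < 2 * real d * p" using d assms(2) by simp
  then have m: "0 < m" "2 * real d * p \<le> real m" unfolding m_def by linarith+
  obtain C where C: "0 \<le> C" "\<And>k n. (2 * k\<^sup>2 * m) ^ d \<le> n \<Longrightarrow> e_wor_std \<gamma> n \<le> ennreal (C / real (k + 1) ^ m)"
    using e_wor_std_grid[of \<gamma> m] assms(1) m(1) by (metis d_def less_imp_le)
  define B where "B = (2 * real m) powr (real d * p)"
  have "e_wor_std \<gamma> n \<le> ennreal (C * B * real n powr (- p))" if n: "1 \<le> n" for n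
  proof -
    define P where "P k \<longleftrightarrow> (2 * k\<^sup>2 * m) ^ d \<le> n" for k
    have P0: "P 0" using d by (simp add: P_def power_0_left)
    have bnd: "k \<le> n" if "P k" for k
    proof -
      have "k \<le> k\<^sup>2" by (simp add: power2_eq_square)
      also have "\<dots> \<le> 2 * k\<^sup>2 * m" using m(1) by simp
      also have "\<dots> \<le> (2 * k\<^sup>2 * m) ^ d" using d by (cases "2 * k\<^sup>2 * m = 0") (auto intro: self_le_power)
      finally show ?thesis using that by (simp add: P_def)
    qed
    \<comment> \<open>The finest grid affordable with \<open>n\<close> points; its maximality bounds
      \<open>n\<close> by the size of the next grid, which converts powers of \<open>k + 1\<close>
      into powers of \<open>n\<close>.\<close>
    define k where "k = Greatest P"
    have "P k" unfolding k_def using P0 bnd by (rule GreatestI_nat)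
    have "\<not> P (k + 1)" using Greatest_le_nat[of P "k + 1" n] bnd by (auto simp: k_def)
    then have "n \<le> (2 * (k + 1)\<^sup>2 * m) ^ d" by (simp add: P_def)
    then have "real n \<le> real ((2 * (k + 1)\<^sup>2 * m) ^ d)" by (simp only: of_nat_le_iff)
    then have "real n \<le> (2 * (real (k + 1))\<^sup>2 * real m) ^ d" by simp
    also have "\<dots> = (2 * (real (k + 1))\<^sup>2 * real m) powr real d"
      using m(1) by (intro powr_realpow[symmetric]) auto
    finally have "real n powr p \<le> ((2 * (real (k + 1))\<^sup>2 * real m) powr real d) powr p"
      using assms(2) by (intro powr_mono2) auto
    also have "\<dots> = (2 * real m * real (k + 1) powr 2) powr (real d * p)"
      by (simp add: powr_powr mult_ac)
    also have "\<dots> = B * real (k + 1) powr (2 * real d * p)"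
      by (simp only: B_def powr_mult powr_powr mult.assoc)
    also have "\<dots> \<le> B * real (k + 1) powr real m"
      using m(2) by (intro mult_left_mono powr_mono) (auto simp: B_def)
    finally have "real n powr p \<le> B * real (k + 1) ^ m" by (simp add: powr_realpow)
    then have "1 / real (k + 1) ^ m \<le> B * real n powr (- p)"
      using n by (simp add: powr_minus field_simps)
    then have "C * (1 / real (k + 1) ^ m) \<le> C * (B * real n powr (- p))"
      using C(1) by (rule mult_left_mono)
    then have "ennreal (C / real (k + 1) ^ m) \<le> ennreal (C * B * real n powr (- p))"
      by (intro ennreal_leI) (simp add: mult.assoc)
    with C(2)[of k n] \<open>P k\<close> show ?thesis by (auto simp: P_def)
  qed
  \<comment> \<open>Evaluations are continuous functionals, so the infimum on the left runs over
    more algorithms.\<close>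
  moreover have "e_wor_all \<gamma> n \<le> e_wor_std \<gamma> n" for n
    unfolding e_wor_all_def e_wor_std_def min_wce_def
    using Lambda_std_subset_all[of \<gamma>] by (intro INF_superset_mono) auto
  ultimately show ?thesis by blast
qed

end
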